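(* Let $\mathcal{I}$ and $\mathcal{J}$ be the focal and partner samples of the pair-interaction model described in the context. Assume that the treatments $\{D_k\}_{k\in\mathcal{I}\cup\mathcal{J}}$ are mutually independent with $\Pr(D_i=d)=p_d^{\mathcal{I}}$ for $i\in\mathcal{I}$ and $\Pr(D_j=d)=p_d^{\mathcal{J}}$ for $j\in\mathcal{J}$, $d\in\{0,1\}$, and that for each $(d,s)\in\{0,1\}^2$, $(D_i,D_{j(i)})$ is independent of $(Y_i(d,s),A_{j(i)})$. Assume also that the potential outcomes $\{Y_i(d,s)\}_{(d,s)\in\{0,1\}^2}$ together with $A_{j(i)}$ are independent and identically distributed across $i\in\mathcal{I}$, with $\Pr(A_{j(i)}=a)=p_a^A$, $a\in\{0,1\}$. Suppose $(\beta_0^{ols},\beta_d^{ols},\beta_s^{ols})$ is determined (as the unique minimizer) by $$(\beta_0^{ols}, \beta_d^{ols}, \beta_s^{ols}) = \operatorname*{argmin}_{b_0, b_d, b_s\in\mathbb{R}} \mathbb{E}[(Y_i - b_0 - b_d D_i - b_s S_i)^2].$$ Then $$\text{(i)}\quad \beta_d^{ols} = \mathbb{E}[\bar\delta_i\mid A_{j(i)}= 1]\, p_1^A + \mathbb{E}[\delta_i(0) \mid A_{j(i)}= 0]\, p_0^A,$$ $$\text{(ii)}\quad \beta_s^{ols} = \mathbb{E}[\bar\tau_i\mid A_{j(i)}= 1] + \bar\eta_i\, \frac{p_0^A}{1 - p_1^A p_1^{\mathcal{J}}},$$ where $\bar\eta_i := \eta_i(1) p_1^{\mathcal{I}} + \eta_i(0)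 p_0^{\mathcal{I}}$ and $\eta_i(d) := \mathbb{E}[Y_i(d,0) \mid A_{j(i)}= 1] - \mathbb{E}[Y_i(d,0) \mid A_{j(i)}= 0]$ for $d\in\{0,1\}$.
   Context: Pair-interaction model. There are two disjoint samples: the focal sample $\mathcal{I}$ and the partner sample $\mathcal{J}$. Each $i\in\mathcal{I}$ has exactly one potential partner $j(i)\in\mathcal{J}$, and $j(i)\neq j(i')$ for $i\neq i'$. Each unit $k\in\mathcal{I}\cup\mathcal{J}$ has a random binary treatment $D_k\in\{0,1\}$. For each pair, $A_{j(i)}\in\{0,1\}$ is a random variable indicating whether $j(i)$'s treatment affects $i$'s outcome. The spillover variable is $S_i := A_{j(i)}D_{j(i)}\in\{0,1\}$. For $(d,s)\in\{0,1\}^2$, $Y_i(d,s)$ is a real random variable (potential outcome), and the observed outcome is $Y_i=\sum_{(d,s)\in\{0,1\}^2}\mathbf{1}\{D_i=d,S_i=s\}Y_i(d,s)$. Experimental design: the treatments $\{D_k\}_{k\in\mathcal{I}\cup\mathcal{J}}$ are mutually independent with $\Pr(D_i=d)=p_d^{\mathcal{I}}$ for $i\in\mathcal{I}$ and $\Pr(D_j=d)=p_d^{\mathcal{J}}$ for $j\in\mathcal{J}$, $d\in\{0,1\}$. In addition, for each $(d,s)\in\{0,1\}^2$, $(D_i,D_{j(i)})$ is independent of $(Y_i(d,s),A_{j(i)})$. IID sampling: the potential outcomes $\{Y_i(d,s)\}_{(d,s)\in\{0,1\}^2}$ together with $A_{j(i)}$ are independent and identically distributed across $i\in\mathcal{I}$,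 with $\Pr(A_{j(i)}=a)=p_a^A$, $a\in\{0,1\}$. ($A_{j(i)}$ may be dependent on $Y_i(d,s)$.) Because of the identical distributions across $i$, the expectations do not depend on $i\in\mathcal{I}$. Potential outcomes have finite second moments. A term consisting of a conditional expectation given a null event multiplied by a zero factor is read as $0$. Direct and spillover effects: $\delta_i(s):=Y_i(1,s)-Y_i(0,s)$, $\bar\delta_i:=\delta_i(1)p_1^{\mathcal{J}}+\delta_i(0)p_0^{\mathcal{J}}$, $\tau_i(d):=Y_i(d,1)-Y_i(d,0)$, $\bar\tau_i:=\tau_i(1)p_1^{\mathcal{I}}+\tau_i(0)p_0^{\mathcal{I}}$. *)

theory Defs
  imports "HOL-Probability.Probability"
begin

text \<open>
  Binary quantities (treatments, interaction indicators, spillover levels, and the arguments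
  \<open>d\<close>, \<open>s\<close> of potential outcomes) are of type \<^typ>\<open>bool\<close>, with \<^const>\<open>True\<close> for 1 and
  \<^const>\<open>False\<close> for 0; \<^const>\<open>of_bool\<close> turns them into real regressors. Focal and partner
  units live in one type, since the treatments are indexed by \<open>I \<union> J\<close>; \<open>A\<close> is indexed by
  partner units.
\<close>

definition pair_interaction ::
  "'w measure \<Rightarrow> 'u set \<Rightarrow> 'u set \<Rightarrow> ('u \<Rightarrow> 'u) \<Rightarrow> ('u \<Rightarrow> 'w \<Rightarrow> bool) \<Rightarrow> ('u \<Rightarrow> 'w \<Rightarrow> bool) \<Rightarrow>
   ('u \<Rightarrow> bool \<Rightarrow> bool \<Rightarrow> 'w \<Rightarrow> real) \<Rightarrow> bool" where
  "pair_interaction M I J partner D A Y \<longleftrightarrow>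
     prob_space M \<and>
     I \<inter> J = {} \<and> partner ` I \<subseteq> J \<and> inj_on partner I \<and>
     (\<forall>k\<in>I \<union> J. D k \<in> measurable M (count_space UNIV)) \<and>
     (\<forall>i\<in>I. A (partner i) \<in> measurable M (count_space UNIV)) \<and>
     (\<forall>i\<in>I. \<forall>d s. Y i d s \<in> borel_measurable M \<and> integrable M (\<lambda>w. (Y i d s w)\<^sup>2))"

text \<open>Same content as \<^const>\<open>prob_space.indep_var\<close>, which requires both random variables to have
  the same range type: the generated \<open>\<sigma>\<close>-algebras are independent.\<close>

definition indep_rv :: "'w measure \<Rightarrow> 'a measure \<Rightarrow> ('w \<Rightarrow> 'a) \<Rightarrow> 'b measure \<Rightarrow> ('w \<Rightarrow> 'b) \<Rightarrow> bool" where
  "indep_rv M N X N' X' \<longleftrightarrow>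
     X \<in> measurable M N \<and> X' \<in> measurable M N' \<and>
     prob_space.indep_set M
       (sigma_sets (space M) {X -` B \<inter> space M | B. B \<in> sets N})
       (sigma_sets (space M) {X' -` B \<inter> space M | B. B \<in> sets N'})"

lemma indep_rv_eq_indep_var:
  assumes "prob_space M"
  shows "indep_rv M N X N' X' \<longleftrightarrow> prob_space.indep_var M N X N' X'"
  using assms by (simp add: indep_rv_def prob_space.indep_var_eq)

definition experimental_design ::
  "'w measure \<Rightarrow> 'u set \<Rightarrow> 'u set \<Rightarrow> ('u \<Rightarrow> 'u) \<Rightarrow> ('u \<Rightarrow> 'w \<Rightarrow> bool) \<Rightarrow> ('u \<Rightarrow> 'w \<Rightarrow> bool) \<Rightarrow>
   ('u \<Rightarrow> bool \<Rightarrow> bool \<Rightarrow> 'w \<Rightarrow> real) \<Rightarrow> (bool \<Rightarrow> real) \<Rightarrow> (bool \<Rightarrow> real) \<Rightarrow> bool" where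
  "experimental_design M I J partner D A Y pI pJ \<longleftrightarrow>
     prob_space.indep_vars M (\<lambda>_. count_space UNIV) D (I \<union> J) \<and>
     (\<forall>i\<in>I. \<forall>d. \<P>(w in M. D i w = d) = pI d) \<and>
     (\<forall>k\<in>J. \<forall>d. \<P>(w in M. D k w = d) = pJ d) \<and>
     (\<forall>i\<in>I. \<forall>d s. indep_rv M
        (count_space UNIV \<Otimes>\<^sub>M count_space UNIV) (\<lambda>w. (D i w, D (partner i) w))
        (borel \<Otimes>\<^sub>M count_space UNIV) (\<lambda>w. (Y i d s w, A (partner i) w)))"

definition unit_data ::
  "('u \<Rightarrow> 'u) \<Rightarrow> ('u \<Rightarrow> 'w \<Rightarrow> bool) \<Rightarrow> ('u \<Rightarrow> bool \<Rightarrow> bool \<Rightarrow> 'w \<Rightarrow> real) \<Rightarrow> 'u \<Rightarrow> 'w \<Rightarrow>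
   (bool \<times> bool \<Rightarrow> real) \<times> bool" where
  "unit_data partner A Y i w = ((\<lambda>(d, s). Y i d s w), A (partner i) w)"

definition unit_data_space :: "((bool \<times> bool \<Rightarrow> real) \<times> bool) measure" where
  "unit_data_space = (\<Pi>\<^sub>M ds\<in>UNIV. borel) \<Otimes>\<^sub>M count_space UNIV"

definition iid_sampling ::
  "'w measure \<Rightarrow> 'u set \<Rightarrow> ('u \<Rightarrow> 'u) \<Rightarrow> ('u \<Rightarrow> 'w \<Rightarrow> bool) \<Rightarrow>
   ('u \<Rightarrow> bool \<Rightarrow> bool \<Rightarrow> 'w \<Rightarrow> real) \<Rightarrow> (bool \<Rightarrow> real) \<Rightarrow> bool" where
  "iid_sampling M I partner A Y pA \<longleftrightarrow>
     prob_space.indep_vars M (\<lambda>_. unit_data_space) (unit_data partner A Y) I \<and>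
     (\<forall>i\<in>I. \<forall>i'\<in>I. distr M unit_data_space (unit_data partner A Y i)
                   = distr M unit_data_space (unit_data partner A Y i')) \<and>
     (\<forall>i\<in>I. \<forall>a. \<P>(w in M. A (partner i) w = a) = pA a)"

definition spillover ::
  "('u \<Rightarrow> 'u) \<Rightarrow> ('u \<Rightarrow> 'w \<Rightarrow> bool) \<Rightarrow> ('u \<Rightarrow> 'w \<Rightarrow> bool) \<Rightarrow> 'u \<Rightarrow> 'w \<Rightarrow> bool" where
  "spillover partner D A i w \<longleftrightarrow> A (partner i) w \<and> D (partner i) w"

definition observed_outcome ::
  "('u \<Rightarrow> 'u) \<Rightarrow> ('u \<Rightarrow> 'w \<Rightarrow> bool) \<Rightarrow> ('u \<Rightarrow> 'w \<Rightarrow> bool) \<Rightarrow>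
   ('u \<Rightarrow> bool \<Rightarrow> bool \<Rightarrow> 'w \<Rightarrow> real) \<Rightarrow> 'u \<Rightarrow> 'w \<Rightarrow> real" where
  "observed_outcome partner D A Y i w =
     (\<Sum>(d, s)\<in>UNIV. of_bool (D i w = d \<and> spillover partner D A i w = s) * Y i d s w)"

text \<open>Elementary conditional expectation given an event. Given a null event it is 0, because of
  division by zero; in particular its product with a zero factor is 0.\<close>

definition cond_expectation :: "'w measure \<Rightarrow> ('w \<Rightarrow> real) \<Rightarrow> ('w \<Rightarrow> bool) \<Rightarrow> real" where
  "cond_expectation M X P = (LINT w:{w\<in>space M. P w}|M. X w) / \<P>(w in M. P w)"

definition direct_effect :: "('u \<Rightarrow> bool \<Rightarrow> bool \<Rightarrow> 'w \<Rightarrow> real) \<Rightarrow> 'u \<Rightarrow> bool \<Rightarrow> 'w \<Rightarrow> real" where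
  "direct_effect Y i s w = Y i True s w - Y i False s w"

definition mean_direct_effect ::
  "('u \<Rightarrow> bool \<Rightarrow> bool \<Rightarrow> 'w \<Rightarrow> real) \<Rightarrow> (bool \<Rightarrow> real) \<Rightarrow> 'u \<Rightarrow> 'w \<Rightarrow> real" where
  "mean_direct_effect Y pJ i w =
     direct_effect Y i True w * pJ True + direct_effect Y i False w * pJ False"

definition spillover_effect :: "('u \<Rightarrow> bool \<Rightarrow> bool \<Rightarrow> 'w \<Rightarrow> real) \<Rightarrow> 'u \<Rightarrow> bool \<Rightarrow> 'w \<Rightarrow> real" where
  "spillover_effect Y i d w = Y i d True w - Y i d False w"

definition mean_spillover_effect ::
  "('u \<Rightarrow> bool \<Rightarrow> bool \<Rightarrow> 'w \<Rightarrow> real) \<Rightarrow> (bool \<Rightarrow> real) \<Rightarrow> 'u \<Rightarrow> 'w \<Rightarrow> real" where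
  "mean_spillover_effect Y pI i w =
     spillover_effect Y i True w * pI True + spillover_effect Y i False w * pI False"

definition selection_effect ::
  "'w measure \<Rightarrow> ('u \<Rightarrow> 'u) \<Rightarrow> ('u \<Rightarrow> 'w \<Rightarrow> bool) \<Rightarrow>
   ('u \<Rightarrow> bool \<Rightarrow> bool \<Rightarrow> 'w \<Rightarrow> real) \<Rightarrow> 'u \<Rightarrow> bool \<Rightarrow> real" where
  "selection_effect M partner A Y i d =
     cond_expectation M (Y i d False) (\<lambda>w. A (partner i) w = True)
     - cond_expectation M (Y i d False) (\<lambda>w. A (partner i) w = False)"

definition mean_selection_effect ::
  "'w measure \<Rightarrow> ('u \<Rightarrow> 'u) \<Rightarrow> ('u \<Rightarrow> 'w \<Rightarrow> bool) \<Rightarrow>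
   ('u \<Rightarrow> bool \<Rightarrow> bool \<Rightarrow> 'w \<Rightarrow> real) \<Rightarrow> (bool \<Rightarrow> real) \<Rightarrow> 'u \<Rightarrow> real" where
  "mean_selection_effect M partner A Y pI i =
     selection_effect M partner A Y i True * pI True
     + selection_effect M partner A Y i False * pI False"

definition ols_risk ::
  "'w measure \<Rightarrow> ('u \<Rightarrow> 'u) \<Rightarrow> ('u \<Rightarrow> 'w \<Rightarrow> bool) \<Rightarrow> ('u \<Rightarrow> 'w \<Rightarrow> bool) \<Rightarrow>
   ('u \<Rightarrow> bool \<Rightarrow> bool \<Rightarrow> 'w \<Rightarrow> real) \<Rightarrow> 'u \<Rightarrow> real \<times> real \<times> real \<Rightarrow> real" where
  "ols_risk M partner D A Y i = (\<lambda>(b0, bd, bs).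
     (LINT w|M. (observed_outcome partner D A Y i w - b0 - bd * of_bool (D i w)
                 - bs * of_bool (spillover partner D A i w))\<^sup>2))"

definition is_unique_arg_min :: "('a \<Rightarrow> 'b::ord) \<Rightarrow> 'a \<Rightarrow> bool" where
  "is_unique_arg_min f x \<longleftrightarrow>
     is_arg_min f (\<lambda>_. True) x \<and> (\<forall>y. is_arg_min f (\<lambda>_. True) y \<longrightarrow> y = x)"

end

theory Submission
  imports Defs
begin

text \<open>
  Since \<open>D\<^sub>i\<close>, \<open>D\<^bsub>j(i)\<^esub>\<close> and \<open>A\<^bsub>j(i)\<^esub>\<close> are mutually independent, the two regressors \<open>D\<^sub>i\<close> and \<open>S\<^sub>i\<close> are
  independent, so the normal equations decouple and each slope is a difference of group means,
  \<open>E[Y | D = 1] - E[Y | D = 0]\<close> and \<open>E[Y | S = 1] - E[Y | S = 0]\<close>. Uniqueness of the minimizer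
  forces both regressors to be nondegenerate. The group means follow from the factorization
  \<open>E[1{D\<^sub>i = d, D\<^bsub>j(i)\<^esub> = e} 1{A = a} Y(d, s)] = P(D\<^sub>i = d) P(D\<^bsub>j(i)\<^esub> = e) E[1{A = a} Y(d, s)]\<close>;
  the control group \<open>S = 0\<close> mixes the units with \<open>A = 0\<close> and those with \<open>A = 1\<close>,
  \<open>D\<^bsub>j(i)\<^esub> = 0\<close>, which produces the selection term.
\<close>

section \<open>Normal equations of the least-squares problem\<close>

text \<open>The squared error along the line \<open>r - t * x\<close> is a quadratic in
  \<open>t\<close> with its minimum at 0, so its linear coefficient has to vanish. This replaces
  differentiation of the risk.\<close>

lemma (in prob_space) least_squares_residual_orthogonal:
  fixes r x :: "'a \<Rightarrow> real"
  assumes [measurable]: "r \<in> borel_measurable M" "x \<in> borel_measurable M"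
    and r2: "integrable M (\<lambda>w. (r w)\<^sup>2)" and x2: "integrable M (\<lambda>w. (x w)\<^sup>2)"
    and min: "\<And>t. (LINT w|M. (r w)\<^sup>2) \<le> (LINT w|M. (r w - t * x w)\<^sup>2)"
  shows "(LINT w|M. r w * x w) = 0"
proof -
  define c v where "c = (LINT w|M. r w * x w)" and "v = (LINT w|M. (x w)\<^sup>2)"
  have v: "v \<ge> 0"
    unfolding v_def by simp
  have rx: "integrable M (\<lambda>w. r w * x w)"
  proof (rule Bochner_Integration.integrable_bound)
    show "integrable M (\<lambda>w. (r w)\<^sup>2 + (x w)\<^sup>2)"
      using r2 x2 by simp
    have "\<bar>r w * x w\<bar> \<le> (r w)\<^sup>2 + (x w)\<^sup>2" for w
      using sum_squares_bound[of "r w" "x w"] sum_squares_bound[of "r w" "- x w"]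
      by (simp add: abs_le_iff)
    then show "AE w in M. norm (r w * x w) \<le> norm ((r w)\<^sup>2 + (x w)\<^sup>2)"
      by simp
  qed simp
  have quad: "2 * t * c \<le> t\<^sup>2 * v" for t
  proof -
    have "(LINT w|M. (r w - t * x w)\<^sup>2) = (LINT w|M. (r w)\<^sup>2 - 2 * t * (r w * x w) + t\<^sup>2 * (x w)\<^sup>2)"
      by (intro Bochner_Integration.integral_cong) (auto simp: power2_eq_square algebra_simps)
    also have "\<dots> = (LINT w|M. (r w)\<^sup>2) - 2 * t * c + t\<^sup>2 * v"
      using r2 x2 rx by (simp add: c_def v_def)
    finally show ?thesis
      using min[of t] by simp
  qed
  \<comment> \<open>The vertex of the quadratic is \<open>c / v\<close>. The denominator
    \<open>v + 1\<close> avoids the case \<open>v = 0\<close> and still gives a contradiction unless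
    \<open>c = 0\<close>: \<open>quad\<close> then reads
    \<open>2 * t\<^sup>2 * (v + 1) \<le> t\<^sup>2 * v\<close>.\<close>
  define t where "t = c / (v + 1)"
  then have c: "c = t * (v + 1)"
    using v by simp
  have "t\<^sup>2 * (v + 2) \<le> 0"
    using quad[of t] by (simp add: c algebra_simps power2_eq_square)
  with v have "t = 0"
    by (simp add: mult_le_0_iff)
  with c show ?thesis
    by (simp add: c_def)
qed

lemma (in prob_space) expectation_of_bool:
  assumes "Measurable.pred M P"
  shows "(LINT w|M. of_bool (P w) :: real) = \<P>(w in M. P w)"
proof -
  have "(LINT w|M. of_bool (P w) :: real) = (LINT w|M. indicator {w\<in>space M. P w} w)"
    by (intro Bochner_Integration.integral_cong) (auto simp: indicator_def)
  then show ?thesis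
    using assms by simp
qed

text \<open>Subtracting \<open>u\<close> times the intercept equation from the equation for
  \<open>U\<close> cancels both \<open>\<beta>0\<close> and, thanks to \<open>uv\<close>, the term
  in \<open>\<beta>2\<close>; likewise for \<open>V\<close>. The slopes are stated multiplied by the
  variances \<open>u * (1 - u)\<close> and \<open>v * (1 - v)\<close>, which keeps the formulas free
  of division.\<close>

lemma (in prob_space) ols_two_binary_regressors:
  fixes y :: "'a \<Rightarrow> real" and U V :: "'a \<Rightarrow> bool"
  assumes y [measurable]: "y \<in> borel_measurable M" and y2: "integrable M (\<lambda>w. (y w)\<^sup>2)"
    and [measurable]: "Measurable.pred M U" "Measurable.pred M V"
    and uv: "\<P>(w in M. U w \<and> V w) = \<P>(w in M. U w) * \<P>(w in M. V w)"
    and ols: "is_unique_arg_min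
      (\<lambda>(b0, b1, b2). LINT w|M. (y w - b0 - b1 * of_bool (U w) - b2 * of_bool (V w))\<^sup>2) (\<beta>0, \<beta>1, \<beta>2)"
  defines "u \<equiv> \<P>(w in M. U w)" and "v \<equiv> \<P>(w in M. V w)"
  shows "0 < u \<and> u < 1 \<and> 0 < v \<and> v < 1
    \<and> \<beta>1 * (u * (1 - u)) = (LINT w|M. y w * of_bool (U w)) - u * (LINT w|M. y w)
    \<and> \<beta>2 * (v * (1 - v)) = (LINT w|M. y w * of_bool (V w)) - v * (LINT w|M. y w)"
proof -
  define R where
    "R = (\<lambda>(b0, b1, b2). LINT w|M. (y w - b0 - b1 * of_bool (U w) - b2 * of_bool (V w))\<^sup>2)"
  have R: "is_unique_arg_min R (\<beta>0, \<beta>1, \<beta>2)"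
    using ols by (simp only: R_def)
  then have min: "R (\<beta>0, \<beta>1, \<beta>2) \<le> R b" for b
    unfolding is_unique_arg_min_def is_arg_min_def not_less[symmetric] by blast
  have uniq: "b = (\<beta>0, \<beta>1, \<beta>2)" if "R b = R (\<beta>0, \<beta>1, \<beta>2)" for b
  proof -
    have "is_arg_min R (\<lambda>_. True) b"
      using min that by (simp add: is_arg_min_def not_less)
    with R show ?thesis
      by (simp only: is_unique_arg_min_def)
  qed
  \<comment> \<open>A regressor that is a.s. constant is collinear with the intercept, contradicting uniqueness.\<close>
  have U_const: "\<not> (AE w in M. U w = c)" for c
  proof
    assume "AE w in M. U w = c"
    then have "R (\<beta>0 + of_bool c, \<beta>1 - 1, \<beta>2) = R (\<beta>0, \<beta>1, \<beta>2)"
      unfolding R_def prod.case by (intro integral_cong_AE) (auto elim!: eventually_mono simp: algebra_simps)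
    from uniq[OF this] show False by simp
  qed
  have V_const: "\<not> (AE w in M. V w = c)" for c
  proof
    assume "AE w in M. V w = c"
    then have "R (\<beta>0 + of_bool c, \<beta>1, \<beta>2 - 1) = R (\<beta>0, \<beta>1, \<beta>2)"
      unfolding R_def prod.case by (intro integral_cong_AE) (auto elim!: eventually_mono simp: algebra_simps)
    from uniq[OF this] show False by simp
  qed
  have nondegenerate: "0 < \<P>(w in M. P w) \<and> \<P>(w in M. P w) < 1"
    if [measurable]: "Measurable.pred M P" and P: "\<And>c. \<not> (AE w in M. P w = c)" for P
  proof -
    have "\<P>(w in M. P w) \<noteq> 1"
      using P[of True] prob_Collect_eq_1[of P] by simp
    moreover have "\<P>(w in M. P w) \<noteq> 0"
      using P[of False] prob_Collect_eq_0[of P] by simp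
    ultimately show ?thesis
      by (simp add: order_less_le)
  qed
  have bounds: "0 < u" "u < 1" "0 < v" "v < 1"
    using nondegenerate[of U] nondegenerate[of V] U_const V_const by (simp_all add: u_def v_def)

  define r where "r w = y w - \<beta>0 - \<beta>1 * of_bool (U w) - \<beta>2 * of_bool (V w)" for w
  have r_meas [measurable]: "r \<in> borel_measurable M"
    unfolding r_def by measurable
  have y1: "integrable M y"
    using square_integrable_imp_integrable[OF y] y2 by simp
  have yP: "integrable M (\<lambda>w. y w * of_bool (P w))" if [measurable]: "Measurable.pred M P" for P
    by (rule Bochner_Integration.integrable_bound[OF y1]) auto
  have of_bool_sq: "(of_bool P :: real)\<^sup>2 = of_bool P" for P
    by simp
  have P_int: "integrable M (\<lambda>w. of_bool (P w) :: real)" if [measurable]: "Measurable.pred M P" for P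
    by (rule integrable_const_bound[of _ 1]) auto
  have r2: "integrable M (\<lambda>w. (r w)\<^sup>2)"
  proof -
    \<comment> \<open>\<open>g\<close> is the bounded part of the residual \<open>r = y + g\<close>,
      so \<open>(r w)\<^sup>2\<close> is dominated by twice the sum of two integrable
      squares.\<close>
    define g :: "'a \<Rightarrow> real" where "g w = - \<beta>0 - \<beta>1 * of_bool (U w) - \<beta>2 * of_bool (V w)" for w
    have [measurable]: "g \<in> borel_measurable M"
      unfolding g_def by measurable
    have "\<bar>g w\<bar> \<le> \<bar>\<beta>0\<bar> + \<bar>\<beta>1\<bar> + \<bar>\<beta>2\<bar>" for w
      by (auto simp: g_def of_bool_def)
    then have "integrable M (\<lambda>w. (g w)\<^sup>2)"
      by (intro integrable_const_bound[of _ "(\<bar>\<beta>0\<bar> + \<bar>\<beta>1\<bar> + \<bar>\<beta>2\<bar>)\<^sup>2"])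
        (auto intro!: power2_le_imp_le simp: abs_le_square_iff[symmetric])
    then have "integrable M (\<lambda>w. 2 * (y w)\<^sup>2 + 2 * (g w)\<^sup>2)"
      using y2 by simp
    then show ?thesis
    proof (rule Bochner_Integration.integrable_bound)
      have "(r w)\<^sup>2 \<le> 2 * (y w)\<^sup>2 + 2 * (g w)\<^sup>2" for w
      proof -
        have "r w = y w + g w" by (simp add: r_def g_def)
        then show ?thesis
          using sum_squares_bound[of "y w" "g w"] by (simp add: power2_sum)
      qed
      then show "AE w in M. norm ((r w)\<^sup>2) \<le> norm (2 * (y w)\<^sup>2 + 2 * (g w)\<^sup>2)"
        by simp
    qed simp
  qed
  \<comment> \<open>Raising one coefficient by \<open>t\<close> changes the residual to
    \<open>r - t * x\<close>, where \<open>x\<close> is the corresponding regressor: 1,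
    \<open>U\<close> or \<open>V\<close> in turn.\<close>
  have "(LINT w|M. r w * 1) = 0"
  proof (rule least_squares_residual_orthogonal[OF _ _ r2])
    show "(LINT w|M. (r w)\<^sup>2) \<le> (LINT w|M. (r w - t * 1)\<^sup>2)" for t
      using min[of "(\<beta>0 + t, \<beta>1, \<beta>2)"] by (simp add: R_def r_def algebra_simps)
  qed simp_all
  moreover have "(LINT w|M. r w * of_bool (U w)) = 0"
  proof (rule least_squares_residual_orthogonal[OF _ _ r2])
    show "(LINT w|M. (r w)\<^sup>2) \<le> (LINT w|M. (r w - t * of_bool (U w))\<^sup>2)" for t
      using min[of "(\<beta>0, \<beta>1 + t, \<beta>2)"] by (simp add: R_def r_def algebra_simps)
  qed (simp_all add: P_int of_bool_sq)
  moreover have "(LINT w|M. r w * of_bool (V w)) = 0"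
  proof (rule least_squares_residual_orthogonal[OF _ _ r2])
    show "(LINT w|M. (r w)\<^sup>2) \<le> (LINT w|M. (r w - t * of_bool (V w))\<^sup>2)" for t
      using min[of "(\<beta>0, \<beta>1, \<beta>2 + t)"] by (simp add: R_def r_def algebra_simps)
  qed (simp_all add: P_int of_bool_sq)
  \<comment> \<open>A single expansion for an arbitrary indicator; taken at \<open>True\<close>,
    \<open>U\<close> and \<open>V\<close> it turns the three orthogonality relations into a linear
    system.\<close>
  moreover have "(LINT w|M. r w * of_bool (P w)) = (LINT w|M. y w * of_bool (P w)) - \<beta>0 * \<P>(w in M. P w)
      - \<beta>1 * \<P>(w in M. U w \<and> P w) - \<beta>2 * \<P>(w in M. V w \<and> P w)"
    if [measurable]: "Measurable.pred M P" for P
  proof -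
    have "(LINT w|M. r w * of_bool (P w)) = (LINT w|M. y w * of_bool (P w) - \<beta>0 * of_bool (P w)
      - \<beta>1 * of_bool (U w \<and> P w) - \<beta>2 * of_bool (V w \<and> P w))"
      by (intro Bochner_Integration.integral_cong) (auto simp: r_def)
    also have "\<dots> = (LINT w|M. y w * of_bool (P w)) - \<beta>0 * (LINT w|M. of_bool (P w))
      - \<beta>1 * (LINT w|M. of_bool (U w \<and> P w)) - \<beta>2 * (LINT w|M. of_bool (V w \<and> P w))"
      by (simp add: yP P_int del: of_bool_conj)
    finally show ?thesis
      by (simp add: expectation_of_bool del: of_bool_conj)
  qed
  note this[of "\<lambda>_. True"] this[of U] this[of V]
  ultimately have
    "(LINT w|M. y w) = \<beta>0 + \<beta>1 * u + \<beta>2 * v"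
    "(LINT w|M. y w * of_bool (U w)) = \<beta>0 * u + \<beta>1 * u + \<beta>2 * (u * v)"
    "(LINT w|M. y w * of_bool (V w)) = \<beta>0 * v + \<beta>1 * (u * v) + \<beta>2 * v"
    using uv by (simp_all add: u_def v_def prob_space conj_commute)
  with bounds show ?thesis
    by (simp add: algebra_simps)
qed

section \<open>Independence and factorization of expectations\<close>

lemma sigma_sets_vimage_comp_subset:
  assumes h: "h \<in> measurable K L" and Z: "Z \<in> measurable M K"
  shows "sigma_sets (space M) {(\<lambda>w. h (Z w)) -` B \<inter> space M |B. B \<in> sets L}
      \<subseteq> sigma_sets (space M) {Z -` B \<inter> space M |B. B \<in> sets K}"
proof (rule sigma_sets_mono', safe)
  fix B assume "B \<in> sets L"
  then have "h -` B \<inter> space K \<in> sets K"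
    by (rule measurable_sets[OF h])
  moreover have "(\<lambda>w. h (Z w)) -` B \<inter> space M = Z -` (h -` B \<inter> space K) \<inter> space M"
    using measurable_space[OF Z] by auto
  ultimately show "\<exists>Ba. (\<lambda>w. h (Z w)) -` B \<inter> space M = Z -` Ba \<inter> space M \<and> Ba \<in> sets K"
    by blast
qed

text \<open>Composing with \<open>f\<close> and \<open>g\<close> can only shrink the generated
  sigma-algebras, so independence survives. Both variables are then real-valued, and the product
  rule for \<open>indep_var\<close>, which needs equal range types, becomes applicable.\<close>

lemma (in prob_space) indep_rv_expectation_mult:
  fixes f :: "'b \<Rightarrow> real" and g :: "'c \<Rightarrow> real"
  assumes ind: "indep_rv M N X N' X'"
    and [measurable]: "f \<in> borel_measurable N" "g \<in> borel_measurable N'"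
    and f: "integrable M (\<lambda>w. f (X w))" and g: "integrable M (\<lambda>w. g (X' w))"
  shows "integrable M (\<lambda>w. f (X w) * g (X' w))"
    and "(LINT w|M. f (X w) * g (X' w)) = (LINT w|M. f (X w)) * (LINT w|M. g (X' w))"
proof -
  have [measurable]: "X \<in> measurable M N" "X' \<in> measurable M N'"
    using ind by (auto simp: indep_rv_def)
  have "indep_set (sigma_sets (space M) {(\<lambda>w. f (X w)) -` B \<inter> space M |B. B \<in> sets borel})
      (sigma_sets (space M) {(\<lambda>w. g (X' w)) -` B \<inter> space M |B. B \<in> sets borel})"
    using ind sigma_sets_vimage_comp_subset[of f N borel X M] sigma_sets_vimage_comp_subset[of g N' borel X' M]
    unfolding indep_rv_def indep_set_def
    by (elim conjE indep_sets_mono_sets) (auto split: bool.splits)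
  then have "indep_var borel (\<lambda>w. f (X w)) borel (\<lambda>w. g (X' w))"
    by (simp add: indep_var_eq)
  with f g show "integrable M (\<lambda>w. f (X w) * g (X' w))"
    and "(LINT w|M. f (X w) * g (X' w)) = (LINT w|M. f (X w)) * (LINT w|M. g (X' w))"
    using indep_var_integrable indep_var_lebesgue_integral by blast+
qed

lemma cond_expectation_eq:
  "cond_expectation M X P = (LINT w|M. of_bool (P w) * X w) / \<P>(w in M. P w)"
proof -
  have "(LINT w:{w\<in>space M. P w}|M. X w) = (LINT w|M. of_bool (P w) * X w)"
    unfolding set_lebesgue_integral_def
    by (intro Bochner_Integration.integral_cong) (auto simp: indicator_def)
  then show ?thesis
    by (simp add: cond_expectation_def)
qed

section \<open>Treatment cells of the pair-interaction model\<close>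

lemma observed_outcome_eq:
  "observed_outcome partner D A Y i w = Y i (D i w) (spillover partner D A i w) w"
  by (cases "D i w"; cases "spillover partner D A i w")
    (simp_all add: observed_outcome_def UNIV_Times_UNIV[symmetric] UNIV_bool del: UNIV_Times_UNIV)

text \<open>Mutual independence is restricted to the index set \<open>{i, partner i}\<close>. Since
  the two units differ, a separate target value can be prescribed for each through
  \<open>?B\<close>.\<close>

lemma experimental_design_cell_prob:
  assumes design: "experimental_design M I J partner D A Y pI pJ"
    and "prob_space M" "i \<in> I" "partner i \<in> J" "i \<noteq> partner i"
  shows "\<P>(w in M. D i w = d \<and> D (partner i) w = e) = pI d * pJ e"
proof -
  interpret prob_space M by fact
  let ?B = "\<lambda>k. if k = i then {d} else {e}"
  have "indep_vars (\<lambda>_. count_space UNIV) D {i, partner i}"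
    using design assms(3,4) by (auto simp: experimental_design_def intro: indep_vars_subset)
  then have "prob (\<Inter>k\<in>{i, partner i}. D k -` ?B k \<inter> space M)
      = (\<Prod>k\<in>{i, partner i}. prob (D k -` ?B k \<inter> space M))"
    by (rule indep_varsD) auto
  moreover have "(\<Inter>k\<in>{i, partner i}. D k -` ?B k \<inter> space M)
      = {w \<in> space M. D i w = d \<and> D (partner i) w = e}"
    using assms(5) by auto
  moreover have "D k -` {c} \<inter> space M = {w \<in> space M. D k w = c}" for k c
    by auto
  ultimately show ?thesis
    using design assms(3-5) by (simp add: experimental_design_def)
qed

text \<open>The design makes the treatment pair independent of one potential outcome jointly with
  \<open>A\<close>. A general \<open>g\<close> serves both for outcomes weighted by an indicator of
  \<open>A\<close> and for that indicator alone.\<close>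

lemma expectation_cell:
  fixes g :: "real \<times> bool \<Rightarrow> real"
  assumes model: "pair_interaction M I J partner D A Y"
    and design: "experimental_design M I J partner D A Y pI pJ" and i: "i \<in> I"
    and g: "g \<in> borel_measurable (borel \<Otimes>\<^sub>M count_space UNIV)"
    and int: "integrable M (\<lambda>w. g (Y i d' s w, A (partner i) w))"
  shows "integrable M (\<lambda>w. of_bool (D i w = d \<and> D (partner i) w = e) * g (Y i d' s w, A (partner i) w))"
    and "(LINT w|M. of_bool (D i w = d \<and> D (partner i) w = e) * g (Y i d' s w, A (partner i) w))
      = pI d * pJ e * (LINT w|M. g (Y i d' s w, A (partner i) w))"
proof -
  interpret prob_space M
    using model by (simp add: pair_interaction_def)
  have J: "partner i \<in> J" "i \<noteq> partner i"
    using model i by (auto simp: pair_interaction_def)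
  have [measurable]: "Measurable.pred M (D i)" "Measurable.pred M (D (partner i))"
    using model i J by (auto simp: pair_interaction_def)
  define f :: "bool \<times> bool \<Rightarrow> real" where "f = (\<lambda>(x, z). of_bool (x = d \<and> z = e))"
  have f: "f \<in> borel_measurable (count_space UNIV \<Otimes>\<^sub>M count_space UNIV)"
    unfolding f_def by measurable
  have f_int: "integrable M (\<lambda>w. f (D i w, D (partner i) w))"
    unfolding f_def by (rule integrable_const_bound[of _ 1]) auto
  have "indep_rv M (count_space UNIV \<Otimes>\<^sub>M count_space UNIV) (\<lambda>w. (D i w, D (partner i) w))
        (borel \<Otimes>\<^sub>M count_space UNIV) (\<lambda>w. (Y i d' s w, A (partner i) w))"
    using design i by (simp add: experimental_design_def)
  note prod = indep_rv_expectation_mult[OF this f g f_int int]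
  have "(LINT w|M. f (D i w, D (partner i) w)) = pI d * pJ e"
    using experimental_design_cell_prob[OF design prob_space_axioms i J, of d e]
    by (simp add: f_def expectation_of_bool del: of_bool_conj)
  with prod show "integrable M (\<lambda>w. of_bool (D i w = d \<and> D (partner i) w = e) * g (Y i d' s w, A (partner i) w))"
    and "(LINT w|M. of_bool (D i w = d \<and> D (partner i) w = e) * g (Y i d' s w, A (partner i) w))
      = pI d * pJ e * (LINT w|M. g (Y i d' s w, A (partner i) w))"
    by (simp_all add: f_def del: of_bool_conj)
qed

section \<open>The two regression slopes in the model\<close>

theorem proposition2p1:
  fixes M :: "'w measure"
    and I J :: "'u set"
    and partner :: "'u \<Rightarrow> 'u"
    and D A :: "'u \<Rightarrow> 'w \<Rightarrow> bool"
    and Y :: "'u \<Rightarrow> bool \<Rightarrow> bool \<Rightarrow> 'w \<Rightarrow> real"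
    and pI pJ pA :: "bool \<Rightarrow> real"
    and i :: 'u
    and \<beta>\<^sub>0 \<beta>\<^sub>d \<beta>\<^sub>s :: real
  assumes model: "pair_interaction M I J partner D A Y"
    and design: "experimental_design M I J partner D A Y pI pJ"
    and iid: "iid_sampling M I partner A Y pA"
    and i: "i \<in> I"
    and ols: "is_unique_arg_min (ols_risk M partner D A Y i) (\<beta>\<^sub>0, \<beta>\<^sub>d, \<beta>\<^sub>s)"
  shows "\<beta>\<^sub>d = cond_expectation M (mean_direct_effect Y pJ i) (\<lambda>w. A (partner i) w = True) * pA True
              + cond_expectation M (direct_effect Y i False) (\<lambda>w. A (partner i) w = False) * pA False
       \<and> \<beta>\<^sub>s = cond_expectation M (mean_spillover_effect Y pI i) (\<lambda>w. A (partner i) w = True)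
              + mean_selection_effect M partner A Y pI i * (pA False / (1 - pA True * pJ True))"
proof -
  interpret prob_space M
    using model by (simp add: pair_interaction_def)
  define j where "j = partner i"
  have j: "j \<in> J"
    using model i by (auto simp: pair_interaction_def j_def)
  have [measurable]: "Measurable.pred M (D i)" "Measurable.pred M (D j)" "Measurable.pred M (A j)"
      "Y i d s \<in> borel_measurable M" for d s
    using model i j by (auto simp: pair_interaction_def j_def)
  have Y2: "integrable M (\<lambda>w. (Y i d s w)\<^sup>2)" for d s
    using model i by (simp add: pair_interaction_def)
  have Y1: "integrable M (Y i d s)" for d s
    by (rule square_integrable_imp_integrable[OF _ Y2]) simp
  define S where "S w \<longleftrightarrow> A j w \<and> D j w" for w
  have S: "spillover partner D A i = S"
    by (simp add: fun_eq_iff spillover_def S_def j_def)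
  have [measurable]: "Measurable.pred M S"
    unfolding S_def by measurable
  define y where "y w = Y i (D i w) (S w) w" for w
  have y_meas [measurable]: "y \<in> borel_measurable M"
  proof -
    have "y = (\<lambda>w. if D i w then if S w then Y i True True w else Y i True False w
        else if S w then Y i False True w else Y i False False w)"
      by (auto simp: y_def fun_eq_iff)
    then show ?thesis by simp
  qed
  have y2: "integrable M (\<lambda>w. (y w)\<^sup>2)"
  proof (rule Bochner_Integration.integrable_bound)
    show "integrable M (\<lambda>w. \<Sum>d\<in>UNIV. \<Sum>s\<in>UNIV. (Y i d s w)\<^sup>2)"
      using Y2 by simp
    have "(y w)\<^sup>2 \<le> (\<Sum>d\<in>UNIV. \<Sum>s\<in>UNIV. (Y i d s w)\<^sup>2)" for w
      by (cases "D i w"; cases "S w") (simp_all add: y_def UNIV_bool)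
    then show "AE w in M. norm ((y w)\<^sup>2) \<le> norm (\<Sum>d\<in>UNIV. \<Sum>s\<in>UNIV. (Y i d s w)\<^sup>2)"
      by (simp add: sum_nonneg)
  qed simp
  \<comment> \<open>These partial means are the unknowns in which both the slopes and the
    conditional expectations get expressed.\<close>
  define m where "m d s a = (LINT w|M. of_bool (A j w = a) * Y i d s w)" for d s a
  have YA: "integrable M (\<lambda>w. of_bool (A j w = a) * Y i d s w)" for d s a
    by (rule Bochner_Integration.integrable_bound[OF Y1[of d s]]) auto
  have pI: "\<P>(w in M. D i w = d) = pI d" and pJ: "\<P>(w in M. D j w = d) = pJ d" for d
    using design i j by (auto simp: experimental_design_def)
  have pA: "\<P>(w in M. A j w = a) = pA a" for a
    using iid i by (auto simp: iid_sampling_def j_def)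
  have complement: "\<P>(w in M. P w = True) + \<P>(w in M. P w = False) = 1"
    if [measurable]: "Measurable.pred M P" for P
    using prob_neg[of P] by simp
  have pF: "pI False = 1 - pI True" "pJ False = 1 - pJ True" "pA False = 1 - pA True"
    using complement[of "D i"] complement[of "D j"] complement[of "A j"]
    by (simp_all only: pI pJ pA) simp_all

  have cell: "integrable M (\<lambda>w. of_bool (D i w = d \<and> D j w = e) * (of_bool (A j w = a) * Y i d s w))"
      "(LINT w|M. of_bool (D i w = d \<and> D j w = e) * (of_bool (A j w = a) * Y i d s w))
        = pI d * pJ e * m d s a" for d e a s
    using expectation_cell[OF model design i, of "\<lambda>(t, b). of_bool (b = a) * t" d s d e] YA[of a d s]
    by (simp_all add: j_def[symmetric] m_def del: of_bool_conj)
  \<comment> \<open>At each \<open>w\<close> exactly one of the eight cells \<open>(d, e, a)\<close>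
    is active, and there the spillover level is \<open>a \<and> e\<close>. The moments of
    \<open>y\<close> against 1, \<open>D i\<close> and \<open>S\<close> are instances of
    \<open>f\<close>.\<close>
  have moment: "(LINT w|M. y w * f (D i w) (D j w) (A j w))
      = (\<Sum>d\<in>UNIV. \<Sum>e\<in>UNIV. \<Sum>a\<in>UNIV. f d e a * (pI d * pJ e * m d (a \<and> e) a))" for f
  proof -
    have "y w * f (D i w) (D j w) (A j w) = (\<Sum>d\<in>UNIV. \<Sum>e\<in>UNIV. \<Sum>a\<in>UNIV.
        f d e a * (of_bool (D i w = d \<and> D j w = e) * (of_bool (A j w = a) * Y i d (a \<and> e) w)))" for w
      by (cases "D i w"; cases "D j w"; cases "A j w") (simp_all add: y_def S_def UNIV_bool)
    then show ?thesis
      using cell by (simp del: of_bool_conj)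
  qed
  have DS: "\<P>(w in M. D i w = d \<and> S w) = pI d * pJ True * pA True" for d
  proof -
    \<comment> \<open>The chosen \<open>g\<close> ignores the outcome coordinate, so any potential
      outcome may stand in that place.\<close>
    have "(LINT w|M. of_bool (D i w = d \<and> D j w = True) * of_bool (A j w = True))
        = pI d * pJ True * (LINT w|M. of_bool (A j w = True))"
      using expectation_cell(2)[OF model design i, of "\<lambda>(t, b). of_bool (b = True)" d True d True]
      by (simp add: j_def[symmetric] integrable_const_bound[of _ 1] del: of_bool_conj)
    then have "(LINT w|M. of_bool (D i w = d \<and> S w)) = pI d * pJ True * pA True"
      using pA[of True] by (simp add: expectation_of_bool S_def of_bool_conj mult_ac)
    then show ?thesis
      by (simp add: expectation_of_bool del: of_bool_conj)
  qed
  have PS: "\<P>(w in M. S w) = pJ True * pA True"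
  proof -
    have "\<P>(w in M. S w) = \<P>(w in M. D i w = True \<and> S w) + \<P>(w in M. D i w = False \<and> S w)"
      by (subst finite_measure_Union[symmetric]) (auto intro!: arg_cong[where f=prob])
    then show ?thesis
      unfolding DS by (simp add: pF(1) algebra_simps)
  qed
  have D1: "\<P>(w in M. D i w) = pI True"
    using pI[of True] by simp
  have "\<P>(w in M. D i w \<and> S w) = \<P>(w in M. D i w) * \<P>(w in M. S w)"
    using DS[of True] D1 PS by simp
  moreover have "is_unique_arg_min
      (\<lambda>(b0, b1, b2). LINT w|M. (y w - b0 - b1 * of_bool (D i w) - b2 * of_bool (S w))\<^sup>2) (\<beta>\<^sub>0, \<beta>\<^sub>d, \<beta>\<^sub>s)"
    using ols by (simp add: ols_risk_def observed_outcome_eq S y_def)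
  ultimately have slopes: "0 < pI True" "pI True < 1" "0 < pJ True * pA True" "pJ True * pA True < 1"
    "\<beta>\<^sub>d * (pI True * (1 - pI True)) = (LINT w|M. y w * of_bool (D i w)) - pI True * (LINT w|M. y w)"
    "\<beta>\<^sub>s * (pJ True * pA True * (1 - pJ True * pA True))
      = (LINT w|M. y w * of_bool (S w)) - pJ True * pA True * (LINT w|M. y w)"
    using ols_two_binary_regressors[OF y_meas y2, of "D i" S] D1 PS by simp_all
  \<comment> \<open>Nondegeneracy of \<open>S\<close> makes the event \<open>A = 1\<close> non-null;
    \<open>A = 0\<close> may still be null.\<close>
  have pos: "pA True > 0" "pJ True > 0"
    using slopes(3) pJ[of True, symmetric] pA[of True, symmetric] measure_nonneg
    by (metis less_eq_real_def mult_zero_left mult_zero_right less_irrefl)+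

  let ?p = "pI True" and ?q = "pJ True" and ?a = "pA True"
  \<comment> \<open>\<open>h d\<close> is E[Y; S = 0 | D = d]\<close>
  define h where "h d = m d False False + (1 - ?q) * m d False True" for d
  have EY: "(LINT w|M. y w) = ?p * (?q * m True True True + h True)
      + (1 - ?p) * (?q * m False True True + h False)"
    using moment[of "\<lambda>_ _ _. 1"] by (simp add: UNIV_bool pF h_def algebra_simps)
  have EYD: "(LINT w|M. y w * of_bool (D i w)) = ?p * (?q * m True True True + h True)"
    using moment[of "\<lambda>d _ _. of_bool d"] by (simp add: UNIV_bool pF h_def algebra_simps)
  have EYS: "(LINT w|M. y w * of_bool (S w))
      = ?q * (?p * m True True True + (1 - ?p) * m False True True)"
    using moment[of "\<lambda>_ e a. of_bool (a \<and> e)"] by (simp add: S_def UNIV_bool pF algebra_simps)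

  have "\<beta>\<^sub>d * (?p * (1 - ?p)) = (?q * m True True True + h True - (?q * m False True True + h False)) * (?p * (1 - ?p))"
    unfolding slopes(5) EY EYD by (simp add: algebra_simps)
  then have \<beta>d: "\<beta>\<^sub>d = ?q * m True True True + h True - (?q * m False True True + h False)"
    using slopes(1,2) by simp
  have \<beta>s: "\<beta>\<^sub>s = (?p * m True True True + (1 - ?p) * m False True True) / ?a
      - (?p * h True + (1 - ?p) * h False) / (1 - ?a * ?q)"
  proof -
    have "1 - ?a * ?q > 0"
      using slopes(4) by (simp add: mult.commute)
    \<comment> \<open>Both the variance of \<open>S\<close> and the right-hand side of its slope
      equation contain the factor \<open>?q\<close>, which is isolated here in order to be
      cancelled.\<close>
    moreover have "\<beta>\<^sub>s * (?a * (1 - ?a * ?q)) * ?q = ((?p * m True True True + (1 - ?p) * m False True True) * (1 - ?a * ?q)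
        - ?a * (?p * h True + (1 - ?p) * h False)) * ?q"
      using slopes(6) unfolding EY EYS by (simp add: algebra_simps)
    then have "\<beta>\<^sub>s * (?a * (1 - ?a * ?q)) = (?p * m True True True + (1 - ?p) * m False True True) * (1 - ?a * ?q)
        - ?a * (?p * h True + (1 - ?p) * h False)"
      using pos by simp
    ultimately show ?thesis
      using pos by (simp add: field_simps)
  qed

  \<comment> \<open>Conditional expectations in terms of the partial means\<close>
  have ce: "cond_expectation M X (\<lambda>w. A (partner i) w = a) = (LINT w|M. of_bool (A j w = a) * X w) / pA a" for X a
    using pA[of a] by (simp add: cond_expectation_eq j_def)
  have ce_direct: "cond_expectation M (direct_effect Y i s) (\<lambda>w. A (partner i) w = a)
      = (m True s a - m False s a) / pA a" for s a
    using YA by (simp add: ce direct_effect_def right_diff_distrib m_def)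
  have ce_mean_direct: "cond_expectation M (mean_direct_effect Y pJ i) (\<lambda>w. A (partner i) w = a)
      = ((m True True a - m False True a) * ?q + (m True False a - m False False a) * (1 - ?q)) / pA a" for a
  proof -
    have "(LINT w|M. of_bool (A j w = a) * mean_direct_effect Y pJ i w)
       = (LINT w|M. (of_bool (A j w = a) * Y i True True w - of_bool (A j w = a) * Y i False True w) * ?q
         + (of_bool (A j w = a) * Y i True False w - of_bool (A j w = a) * Y i False False w) * (1 - ?q))"
      by (intro Bochner_Integration.integral_cong) (auto simp: mean_direct_effect_def direct_effect_def pF)
    then show ?thesis
      using YA by (simp add: ce m_def)
  qed
  have ce_mean_spillover: "cond_expectation M (mean_spillover_effect Y pI i) (\<lambda>w. A (partner i) w = a)
      = ((m True True a - m True False a) * ?p + (m False True a - m False False a) * (1 - ?p)) / pA a" for a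
  proof -
    have "(LINT w|M. of_bool (A j w = a) * mean_spillover_effect Y pI i w)
       = (LINT w|M. (of_bool (A j w = a) * Y i True True w - of_bool (A j w = a) * Y i True False w) * ?p
         + (of_bool (A j w = a) * Y i False True w - of_bool (A j w = a) * Y i False False w) * (1 - ?p))"
      by (intro Bochner_Integration.integral_cong) (auto simp: mean_spillover_effect_def spillover_effect_def pF)
    then show ?thesis
      using YA by (simp add: ce m_def)
  qed
  have ce_Y: "cond_expectation M (Y i d s) (\<lambda>w. A (partner i) w = a) = m d s a / pA a" for d s a
    by (simp add: ce m_def)

  \<comment> \<open>Division by \<open>pA False = 0\<close> is harmless because the numerator vanishes as well.\<close>
  have m_null: "m d s a / pA a * pA a = m d s a" for d s a
  proof (cases "pA a = 0")
    case True
    then have "AE w in M. A j w \<noteq> a"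
      using prob_Collect_eq_0[of "\<lambda>w. A j w = a"] pA[of a] by simp
    then have "m d s a = 0"
      unfolding m_def by (intro integral_eq_zero_AE) (auto elim!: eventually_mono)
    then show ?thesis by simp
  qed simp
  have "\<beta>\<^sub>d = cond_expectation M (mean_direct_effect Y pJ i) (\<lambda>w. A (partner i) w = True) * pA True
      + cond_expectation M (direct_effect Y i False) (\<lambda>w. A (partner i) w = False) * pA False"
    unfolding \<beta>d ce_mean_direct ce_direct h_def
    using pos m_null[of True False False] m_null[of False False False]
    by (simp add: diff_divide_distrib left_diff_distrib) (simp add: algebra_simps)
  moreover have "\<beta>\<^sub>s = cond_expectation M (mean_spillover_effect Y pI i) (\<lambda>w. A (partner i) w = True)
      + mean_selection_effect M partner A Y pI i * (pA False / (1 - pA True * pJ True))"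
  proof -
    define n where "n = 1 - ?a * ?q"
    have n: "n > 0"
      using slopes(4) by (simp add: n_def mult.commute)
    \<comment> \<open>Including the factor \<open>pA False\<close> lets \<open>m_null\<close> handle
      a null event \<open>A = 0\<close>.\<close>
    define \<eta> where "\<eta> d = selection_effect M partner A Y i d * pA False" for d
    have "\<eta> d = m d False True / ?a * (1 - ?a) - m d False False" for d
      unfolding \<eta>_def selection_effect_def ce_Y left_diff_distrib m_null by (simp only: pF(3))
    \<comment> \<open>If outcomes \<open>Y(d,0)\<close> were unselected, \<open>h d\<close> would be
      E[Y(d,0) | A = 1] times \<open>n = P(S = 0)\<close>; \<open>\<eta> d\<close> is the
      correction. After division by \<open>n\<close> the first term completes the spillover effect
      and the second gives the selection term.\<close>
    then have h: "h d = m d False True / ?a * n - \<eta> d" for d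
      using pos by (simp add: h_def n_def field_simps)
    have mean: "mean_selection_effect M partner A Y pI i * (pA False / n) = (?p * \<eta> True + (1 - ?p) * \<eta> False) / n"
      unfolding mean_selection_effect_def pF(1) \<eta>_def
      by (simp add: distrib_left distrib_right mult_ac add_divide_distrib)
    show ?thesis
      unfolding \<beta>s ce_mean_spillover n_def[symmetric] mean h
      using pos(1) n by (simp add: field_simps)
  qed
  ultimately show ?thesis ..
qed

end
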